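(* Let $\kappa,\tau,T_h>0$, $0<\delta_{\min}<\delta_{\max}$, $\epsilon=\delta_{\max}-\delta_{\min}$, $p_0\in[0,1]$. Let the energy gap of a two-level system be driven at constant rate, $\delta(t)=\delta_{\max}-\epsilon t/\tau$ for $t\in[0,\tau]$, and let the excited-state occupation probability $p$ evolve by partial thermalization with a bath at temperature $T_h$, i.e. $\frac{dp}{dt}(t)=\kappa\big(\gamma_h(\delta(t))-p(t)\big)$ on $[0,\tau]$ with $p(0)=p_0$. Then the average work $\mu_W(\tau)$ done during the process is $$\mu_W(\tau)=W_{iso}^{T_h}+\frac{W_{ad}}{\kappa\tau}\big(1-e^{-\kappa\tau}\big)-\frac{\epsilon}{\kappa\tau}\Big\{\mathcal{G}(\tau)-e^{-\kappa\tau}\mathcal{G}(0)\Big\},$$ where $W_{iso}^{T_h}=T_h\log\big(Z(\delta_{\min})/Z(\delta_{\max})\big)$ and $W_{ad}=\epsilon p_0$.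
   Context: Notation: $\gamma_h(\delta)=\frac{1}{1+e^{\delta/T_h}}$ is the Gibbs weight of the excited state at gap $\delta$ (ground-state energy is zero), and $Z(\delta)=1+e^{-\delta/T_h}$ is the partition function. $\log$ is the natural logarithm. The average work (positive sign means net work gain) is $$\mu_W(\tau)=-\int_{\delta_{\max}}^{\delta_{\min}}p(\delta)\,d\delta,$$ where $p(\delta)$ is the probability of being in the excited state when the gap equals $\delta$; i.e. $\mu_W(\tau)=\frac{\epsilon}{\tau}\int_0^\tau p(t)\,dt$. For $t\in[0,\tau]$, $$\mathcal{G}(t)=-\sum_{n=1}^\infty\frac{\big(-e^{-\delta(t)/T_h}\big)^n}{\frac{n\epsilon}{\kappa\tau T_h}+1}.$$ *)

theory Defs
  imports "HOL-Analysis.Analysis"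
begin

text \<open>
  A two-level system with ground-state energy zero and energy gap \<open>d\<close>, at temperature \<open>T\<close>
  (in units with Boltzmann constant one).
\<close>

definition partition_fun :: "real \<Rightarrow> real \<Rightarrow> real" where
  "partition_fun T d = 1 + exp (- d / T)"

definition gibbs_excited :: "real \<Rightarrow> real \<Rightarrow> real" where
  "gibbs_excited T d = 1 / (1 + exp (d / T))"

definition gap :: "real \<Rightarrow> real \<Rightarrow> real \<Rightarrow> real \<Rightarrow> real" where
  "gap dmin dmax \<tau> t = dmax - (dmax - dmin) * t / \<tau>"

definition time_at_gap :: "real \<Rightarrow> real \<Rightarrow> real \<Rightarrow> real \<Rightarrow> real" where
  "time_at_gap dmin dmax \<tau> d = \<tau> * (dmax - d) / (dmax - dmin)"

lemma gap_time_at_gap: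
  assumes "\<tau> > 0" "dmin < dmax"
  shows "gap dmin dmax \<tau> (time_at_gap dmin dmax \<tau> d) = d"
  using assms by (simp add: gap_def time_at_gap_def)

lemma time_at_gap_gap:
  assumes "\<tau> > 0" "dmin < dmax"
  shows "time_at_gap dmin dmax \<tau> (gap dmin dmax \<tau> t) = t"
  using assms by (simp add: gap_def time_at_gap_def)

text \<open>
  The occupation probability \<open>p\<close> is a function of time; the probability of being excited when
  the gap equals \<open>d\<close> is therefore \<open>p (time_at_gap dmin dmax \<tau> d)\<close>.  The bounds of the
  oriented integral run downwards, from \<open>dmax\<close> to \<open>dmin\<close>.
\<close>

definition average_work :: "real \<Rightarrow> real \<Rightarrow> real \<Rightarrow> (real \<Rightarrow> real) \<Rightarrow> real" where
  "average_work dmin dmax \<tau> p =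
     - (LBINT d=ereal dmax..ereal dmin. p (time_at_gap dmin dmax \<tau> d))"

lemma average_work_eq_time_integral:
  assumes "\<tau> > 0" "dmin < dmax" "continuous_on {0..\<tau>} p"
  shows "average_work dmin dmax \<tau> p = (dmax - dmin) / \<tau> * (LBINT t=ereal 0..ereal \<tau>. p t)"
proof -
  let ?h = "\<lambda>d. time_at_gap dmin dmax \<tau> d"
  let ?c = "- \<tau> / (dmax - dmin)"
  have img: "?h ` {dmin..dmax} \<subseteq> {0..\<tau>}"
    using assms by (auto simp: time_at_gap_def divide_simps)
  have "(LBINT d=ereal dmin..ereal dmax. ?c *\<^sub>R p (?h d)) =
        (LBINT t=ereal (?h dmin)..ereal (?h dmax). p t)"
  proof (rule interval_integral_substitution_finite)
    show "(?h has_real_derivative ?c) (at d within {dmin..dmax})" for d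
      unfolding time_at_gap_def using assms by (auto intro!: derivative_eq_intros)
    show "continuous_on (?h ` {dmin..dmax}) p"
      using assms(3) img by (rule continuous_on_subset)
  qed (use assms in auto)
  also have "?h dmin = \<tau>" using assms by (simp add: time_at_gap_def)
  also have "?h dmax = 0" by (simp add: time_at_gap_def)
  finally have "(LBINT d=ereal dmin..ereal dmax. ?c *\<^sub>R p (?h d)) = - (LBINT t=ereal 0..ereal \<tau>. p t)"
    using interval_integral_endpoints_reverse[of "ereal \<tau>" "ereal 0" p] by metis
  moreover have "(LBINT d=ereal dmin..ereal dmax. ?c *\<^sub>R p (?h d)) =
      ?c * (LBINT d=ereal dmin..ereal dmax. p (?h d))"
    unfolding real_scaleR_def by (rule interval_lebesgue_integral_mult_right)
  ultimately have "?c * (LBINT d=ereal dmin..ereal dmax. p (?h d)) = - (LBINT t=ereal 0..ereal \<tau>. p t)"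
    by simp
  moreover have "average_work dmin dmax \<tau> p = (LBINT d=ereal dmin..ereal dmax. p (?h d))"
    unfolding average_work_def
    by (simp add: interval_integral_endpoints_reverse[of "ereal dmax"])
  ultimately show ?thesis using assms(1,2) by (simp add: field_simps)
qed

definition work_isothermal :: "real \<Rightarrow> real \<Rightarrow> real \<Rightarrow> real" where
  "work_isothermal T dmin dmax = T * ln (partition_fun T dmin / partition_fun T dmax)"

definition work_adiabatic :: "real \<Rightarrow> real \<Rightarrow> real \<Rightarrow> real" where
  "work_adiabatic dmin dmax p0 = (dmax - dmin) * p0"

text \<open>The summation index is shifted: \<open>Suc n\<close> ranges over the integers from one on.\<close>

definition series_G ::
    "real \<Rightarrow> real \<Rightarrow> real \<Rightarrow> real \<Rightarrow> real \<Rightarrow> real \<Rightarrow> real" where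
  "series_G \<kappa> T dmin dmax \<tau> t =
     - (\<Sum>n. (- exp (- gap dmin dmax \<tau> t / T)) ^ Suc n
              / (real (Suc n) * (dmax - dmin) / (\<kappa> * \<tau> * T) + 1))"

end

theory Submission imports Defs begin

text \<open>
  The function \<open>\<G>\<close> is itself a solution of the relaxation equation
  \<open>p' = \<kappa> (\<gamma> - p)\<close>: with \<open>y = -exp(-\<delta>/T)\<close> and \<open>a = \<epsilon>/(\<kappa>\<tau>T)\<close> one has \<open>y' = \<kappa> a y\<close>, and
  \<open>h y = (\<Sum>n. y^n / (n a + 1))\<close> satisfies \<open>a y h' + h = 1 / (1 - y)\<close>.  Hence
  \<open>p t = \<G> t + exp(-\<kappa>t) (p 0 - \<G> 0)\<close>.  Integrating the equation instead of the solution,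
  \<open>\<integral> p = \<integral> \<gamma> - (p \<tau> - p 0) / \<kappa>\<close>, where \<open>\<integral> \<gamma>\<close> gives the isothermal work since
  \<open>\<gamma>\<close> is, up to a constant, the time derivative of \<open>ln Z\<close>.
\<close>

lemma summable_power_over_linear:
  fixes a y :: real
  assumes "a > 0" "\<bar>y\<bar> < 1"
  shows "summable (\<lambda>n. 1 / (real n * a + 1) * y ^ n)"
proof (rule summable_comparison_test')
  show "summable (\<lambda>n. \<bar>y\<bar> ^ n)"
    using assms by (intro summable_geometric) simp
  show "norm (1 / (real n * a + 1) * y ^ n) \<le> \<bar>y\<bar> ^ n" for n
  proof -
    have "\<bar>1 / (real n * a + 1)\<bar> \<le> 1"
      using assms by (simp add: divide_simps)
    from mult_right_mono[OF this, of "\<bar>y\<bar> ^ n"] show ?thesis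
      unfolding real_norm_def abs_mult power_abs by simp
  qed
qed

text \<open>Termwise, \<open>a * y * D + h y\<close> multiplies the coefficient of
  \<open>y ^ n\<close> by \<open>a * n + 1\<close>; this cancels the denominator and leaves the
  geometric series.\<close>

lemma power_over_linear_ode:
  fixes a y :: real
  assumes a: "a > 0" and y: "\<bar>y\<bar> < 1"
  defines "h \<equiv> \<lambda>z. \<Sum>n. 1 / (real n * a + 1) * z ^ n"
  obtains D where "(h has_real_derivative D) (at y)" "a * y * D + h y = 1 / (1 - y)"
proof -
  define c where "c = (\<lambda>n. 1 / (real n * a + 1))"
  define D where "D = (\<Sum>n. diffs c n * y ^ n)"
  have summ: "summable (\<lambda>n. c n * z ^ n)" if "norm z < 1" for z
    using summable_power_over_linear[OF a] that by (simp add: c_def)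
  have der: "((\<lambda>z. \<Sum>n. c n * z ^ n) has_real_derivative D) (at y)"
    unfolding D_def using y by (intro termdiffs_strong'[where K = 1] summ) auto
  have "summable (\<lambda>n. diffs c n * y ^ n)"
    using y by (intro termdiff_converges[where K = 1] summ) auto
  \<comment> \<open>\<open>diffs_equiv\<close> undoes the index shift in \<open>diffs\<close>, so
    that the series can be added termwise to that of \<open>h y\<close>.\<close>
  then have "(\<lambda>n. a * y * (real n * c n * y ^ (n - Suc 0))) sums (a * y * D)"
    unfolding D_def by (intro sums_mult diffs_equiv)
  moreover have "(\<lambda>n. c n * y ^ n) sums h y"
    using summ[of y] y unfolding h_def c_def by (simp add: summable_sums)
  ultimately have "(\<lambda>n. a * y * (real n * c n * y ^ (n - Suc 0)) + c n * y ^ n)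
      sums (a * y * D + h y)"
    by (rule sums_add)
  moreover have "a * y * (real n * c n * y ^ (n - Suc 0)) + c n * y ^ n = y ^ n" for n
  proof -
    \<comment> \<open>For \<open>n = 0\<close> the truncated exponent \<open>n - Suc 0\<close> is
      harmless, since the factor \<open>real n\<close> vanishes.\<close>
    have "a * y * (real n * c n * y ^ (n - Suc 0)) = a * real n * c n * y ^ n"
      by (cases n) auto
    moreover have "(a * real n + 1) * c n = 1"
      using a by (simp add: c_def mult.commute add_nonneg_eq_0_iff)
    ultimately show ?thesis
      by (metis distrib_right mult_1)
  qed
  ultimately have "(\<lambda>n. y ^ n) sums (a * y * D + h y)"
    by simp
  then have "a * y * D + h y = 1 / (1 - y)"
    using geometric_sums[of y] y sums_unique2 by fastforce
  then show ?thesis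
    using that der by (simp add: h_def c_def)
qed

lemma has_real_derivative_gap:
  assumes "\<tau> > 0"
  shows "(gap dmin dmax \<tau> has_real_derivative (dmin - dmax) / \<tau>) (at t within S)"
  unfolding gap_def[abs_def] using assms by (auto intro!: derivative_eq_intros simp: divide_simps)

text \<open>A positive gap puts \<open>- exp (- gap / T)\<close> strictly inside the unit disc, so
  the series converges on all of \<open>{0..\<tau>}\<close>, endpoints included.\<close>

lemma gap_pos:
  assumes "0 < dmin" "dmin < dmax" "t \<in> {0..\<tau>}"
  shows "gap dmin dmax \<tau> t > 0"
\<comment> \<open>For \<open>\<tau> = 0\<close>, division by zero yields 0 and the gap is
  \<open>dmax\<close>.\<close>
proof (cases "\<tau> = 0")
  case False
  then have "(dmax - dmin) * t / \<tau> \<le> dmax - dmin"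
    using assms by (auto simp: divide_simps)
  then show ?thesis
    using assms by (simp add: gap_def)
qed (use assms in \<open>simp add: gap_def\<close>)

text \<open>With \<open>y = - exp (- d / T)\<close> the partition function is \<open>1 - y\<close>,
  so this form meets the right-hand side \<open>1 / (1 - y)\<close> of the power series
  equation.\<close>

lemma gibbs_excited_altdef: "gibbs_excited T d = 1 - 1 / partition_fun T d"
proof -
  have "1 + exp (d / T) > 0" "1 + exp (- d / T) > 0"
    by (simp_all add: add_pos_pos)
  then show ?thesis
    by (simp add: gibbs_excited_def partition_fun_def exp_minus field_simps)
qed

lemma has_real_derivative_ln_partition_fun:
  assumes "T > 0" "\<tau> > 0"
  shows "((\<lambda>t. ln (partition_fun T (gap dmin dmax \<tau> t))) has_real_derivative
           (dmax - dmin) / (\<tau> * T) * gibbs_excited T (gap dmin dmax \<tau> t)) (at t within S)"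
proof -
  have pos: "1 + exp (- gap dmin dmax \<tau> t / T) > 0"
    by (simp add: add_pos_pos)
  have g: "gibbs_excited T (gap dmin dmax \<tau> t) =
      exp (- gap dmin dmax \<tau> t / T) / (1 + exp (- gap dmin dmax \<tau> t / T))"
    using pos by (simp add: gibbs_excited_altdef partition_fun_def field_simps)
  show ?thesis
    unfolding partition_fun_def g
    using assms pos
    by (auto intro!: derivative_eq_intros has_real_derivative_gap simp: divide_simps)
      (simp add: algebra_simps)?
qed

lemma has_real_derivative_series_G:
  assumes "\<kappa> > 0" "\<tau> > 0" "T > 0" "0 < dmin" "dmin < dmax" "t \<in> {0..\<tau>}"
  shows "(series_G \<kappa> T dmin dmax \<tau> has_real_derivative
           \<kappa> * (gibbs_excited T (gap dmin dmax \<tau> t) - series_G \<kappa> T dmin dmax \<tau> t))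
           (at t within {0..\<tau>})"
proof -
  define a where "a = (dmax - dmin) / (\<kappa> * \<tau> * T)"
  define h where "h = (\<lambda>z. \<Sum>n. 1 / (real n * a + 1) * z ^ n)"
  define y where "y = (\<lambda>t. - exp (- gap dmin dmax \<tau> t / T))"
  have a: "a > 0"
    using assms by (simp add: a_def)
  have y: "\<bar>y s\<bar> < 1" if "s \<in> {0..\<tau>}" for s
    using gap_pos[OF assms(4,5) that] assms(3) by (simp add: y_def)
  \<comment> \<open>\<open>series_G\<close> sums from exponent 1, \<open>h\<close> from exponent 0;
    the head term is 1.\<close>
  have G: "series_G \<kappa> T dmin dmax \<tau> s = 1 - h (y s)" if "s \<in> {0..\<tau>}" for s
    using suminf_split_head[OF summable_power_over_linear[OF a y[OF that]]]
    by (simp add: series_G_def h_def a_def y_def mult_ac)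
  obtain D where D: "(h has_real_derivative D) (at (y t))"
    and ode: "a * y t * D + h (y t) = 1 / (1 - y t)"
    using power_over_linear_ode[OF a y[OF assms(6)]] unfolding h_def by blast
  have dy: "(y has_real_derivative \<kappa> * a * y t) (at t within {0..\<tau>})"
    unfolding y_def a_def using assms
    by (auto intro!: derivative_eq_intros has_real_derivative_gap simp: field_simps)
  have "((\<lambda>s. 1 - h (y s)) has_real_derivative - (D * (\<kappa> * a * y t))) (at t within {0..\<tau>})"
    using DERIV_chain2[OF D dy] by (auto intro!: derivative_eq_intros)
  moreover have "- (D * (\<kappa> * a * y t)) =
      \<kappa> * (gibbs_excited T (gap dmin dmax \<tau> t) - series_G \<kappa> T dmin dmax \<tau> t)"
  proof -
    have "gibbs_excited T (gap dmin dmax \<tau> t) = 1 - (a * y t * D + h (y t))"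
      unfolding ode by (simp add: gibbs_excited_altdef partition_fun_def y_def)
    then have "\<kappa> * (a * y t * D) =
        \<kappa> * (series_G \<kappa> T dmin dmax \<tau> t - gibbs_excited T (gap dmin dmax \<tau> t))"
      using G[OF assms(6)] by simp
    then show ?thesis
      by (simp add: algebra_simps)
  qed
  \<comment> \<open>The identity \<open>G\<close> is known only on \<open>{0..\<tau>}\<close>, which
    suffices for a derivative within that interval; the radius 1 is arbitrary.\<close>
  ultimately show ?thesis
    using has_field_derivative_transform_within[of _ _ t "{0..\<tau>}" 1 "series_G \<kappa> T dmin dmax \<tau>"]
      assms(6) G by simp
qed

text \<open>The inhomogeneity \<open>g\<close> drops out of \<open>p - q\<close>, and the
  integrating factor \<open>exp (\<kappa> * t)\<close> makes the difference constant.\<close>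

lemma linear_relaxation_difference:
  fixes p q g :: "real \<Rightarrow> real"
  assumes p: "\<And>t. t \<in> {0..\<tau>} \<Longrightarrow> (p has_real_derivative \<kappa> * (g t - p t)) (at t within {0..\<tau>})"
    and q: "\<And>t. t \<in> {0..\<tau>} \<Longrightarrow> (q has_real_derivative \<kappa> * (g t - q t)) (at t within {0..\<tau>})"
    and t: "t \<in> {0..\<tau>}"
  shows "p t - q t = exp (- \<kappa> * t) * (p 0 - q 0)"
proof -
  have "((\<lambda>s. exp (\<kappa> * s) * (p s - q s)) has_real_derivative 0) (at s within {0..\<tau>})"
    if "s \<in> {0..\<tau>}" for s
    by (rule derivative_eq_intros p[OF that] q[OF that] refl)+ (simp add: algebra_simps)
  then have "\<exists>C. \<forall>s\<in>{0..\<tau>}. exp (\<kappa> * s) * (p s - q s) = C"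
    using has_field_derivative_zero_constant[of "{0..\<tau>}" "\<lambda>s. exp (\<kappa> * s) * (p s - q s)"]
    by auto
  then obtain C where "\<forall>s\<in>{0..\<tau>}. exp (\<kappa> * s) * (p s - q s) = C" ..
  then have "exp (\<kappa> * t) * (p t - q t) = exp (\<kappa> * 0) * (p 0 - q 0)"
    using t by (metis atLeastAtMost_iff order_refl order_trans)
  then have "exp (- \<kappa> * t) * (p 0 - q 0) = exp (- \<kappa> * t) * exp (\<kappa> * t) * (p t - q t)"
    by (simp add: mult.assoc)
  then show ?thesis
    by (simp add: exp_minus)
qed

theorem theorem1:
  fixes \<kappa> \<tau> T\<^sub>h \<delta>min \<delta>max \<epsilon> p\<^sub>0 :: real
    and p :: "real \<Rightarrow> real"
  assumes "\<kappa> > 0" and "\<tau> > 0" and "T\<^sub>h > 0"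
    and "0 < \<delta>min" and "\<delta>min < \<delta>max"
    and "\<epsilon> = \<delta>max - \<delta>min"
    and "p\<^sub>0 \<in> {0..1}"
    and "\<And>t. t \<in> {0..\<tau>} \<Longrightarrow>
           (p has_real_derivative \<kappa> * (gibbs_excited T\<^sub>h (gap \<delta>min \<delta>max \<tau> t) - p t))
             (at t within {0..\<tau>})"
    and "p 0 = p\<^sub>0"
  shows "average_work \<delta>min \<delta>max \<tau> p =
           work_isothermal T\<^sub>h \<delta>min \<delta>max
           + work_adiabatic \<delta>min \<delta>max p\<^sub>0 / (\<kappa> * \<tau>) * (1 - exp (- \<kappa> * \<tau>))
           - \<epsilon> / (\<kappa> * \<tau>) *
               (series_G \<kappa> T\<^sub>h \<delta>min \<delta>max \<tau> \<tau>
                - exp (- \<kappa> * \<tau>) * series_G \<kappa> T\<^sub>h \<delta>min \<delta>max \<tau> 0)"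
proof -
  let ?g = "gap \<delta>min \<delta>max \<tau>" and ?G = "series_G \<kappa> T\<^sub>h \<delta>min \<delta>max \<tau>"
  let ?Z = "partition_fun T\<^sub>h"
  \<comment> \<open>An antiderivative of \<open>p\<close>, read off from
    \<open>p = \<gamma> - p' / \<kappa>\<close>; the factor
    \<open>\<tau> * T\<^sub>h / \<epsilon>\<close> normalises the derivative of \<open>ln Z\<close>
    to \<gamma>.\<close>
  define F where "F = (\<lambda>t. \<tau> * T\<^sub>h / \<epsilon> * ln (?Z (?g t)) - p t / \<kappa>)"
  have eps: "\<epsilon> > 0"
    using assms by simp
  have cont: "continuous_on {0..\<tau>} p"
    using assms(8) DERIV_continuous by (fastforce simp: continuous_on_eq_continuous_within)
  have "(F has_real_derivative p t) (at t within {0..\<tau>})" if "t \<in> {0..\<tau>}" for t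
    unfolding F_def
    by (rule DERIV_cong[OF DERIV_diff[OF
            DERIV_cmult[OF has_real_derivative_ln_partition_fun[OF assms(3,2)]]
            DERIV_cdivide[OF assms(8)[OF that]]]])
      (use assms(1-3) eps in \<open>simp add: assms(6)[symmetric] diff_divide_distrib\<close>)
  then have "(LBINT t=ereal 0..ereal \<tau>. p t) = F \<tau> - F 0"
    using assms(2) cont
    by (intro interval_integral_FTC_finite)
       (auto simp: has_real_derivative_iff_has_vector_derivative)
  also have "\<dots> = \<tau> * T\<^sub>h / \<epsilon> * ln (?Z \<delta>min / ?Z \<delta>max) - (p \<tau> - p\<^sub>0) / \<kappa>"
  proof -
    have "?g 0 = \<delta>max" "?g \<tau> = \<delta>min"
      using assms(2) by (simp_all add: gap_def)
    moreover have "?Z d > 0" "?Z d \<noteq> 0" for d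
      by (simp_all add: partition_fun_def add_pos_pos add_nonneg_eq_0_iff)
    ultimately show ?thesis
      using assms(9) by (simp add: F_def ln_div right_diff_distrib diff_divide_distrib)
  qed
  \<comment> \<open>Only the final value of \<open>p\<close> is still unknown; comparison with the
    particular solution \<open>series_G\<close> supplies it.\<close>
  also have "p \<tau> = ?G \<tau> + exp (- \<kappa> * \<tau>) * (p\<^sub>0 - ?G 0)"
    using linear_relaxation_difference[OF assms(8) has_real_derivative_series_G[OF assms(1-5)],
        of \<tau>] assms(2,9)
    by simp
  finally have int: "(LBINT t=ereal 0..ereal \<tau>. p t) =
      \<tau> * T\<^sub>h / \<epsilon> * ln (?Z \<delta>min / ?Z \<delta>max)
      - (?G \<tau> + exp (- \<kappa> * \<tau>) * (p\<^sub>0 - ?G 0) - p\<^sub>0) / \<kappa>" .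
  \<comment> \<open>The prefactor \<open>\<epsilon> / \<tau>\<close> turns the logarithmic term into
    the isothermal work; the two \<open>p\<^sub>0\<close> terms combine into the adiabatic
    one.\<close>
  show ?thesis
    unfolding average_work_eq_time_integral[OF assms(2,5) cont] int assms(6)[symmetric]
      work_isothermal_def work_adiabatic_def
    using assms(1,2) eps by (simp add: field_simps)
qed

end
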